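(* $\mathcal{PH}^{cc} \subseteq \mathcal{BP}\cdot\mathcal{PP}^{cc}$; that is, every language in the communication polynomial hierarchy belongs to the class obtained by applying the BP-operator to the communication class $\mathcal{PP}^{cc}$.
   Context: Let $\mathbb{B}=\{0,1\}$. A language is a set $L\subseteq\{(x,y)\mid x,y\in\mathbb{B}^*,|x|=|y|\}$; its $n$-bit section $L_n$ is the set of $(x,y)\in L$ with $x,y\in\mathbb{B}^n$, viewed also as the Boolean function on $\mathbb{B}^n\times\mathbb{B}^n$ (or $2^n\times 2^n$ Boolean matrix) with value 1 exactly on $L_n$. "$\mathrm{polylog}(n)$" means bounded by $(\log n)^{O(1)}$. Guess protocols and $\mathcal{PP}^{cc}$: a guess protocol $\Pi=(\Pi_1,\dots,\Pi_l)$ over $X\times Y$ is a finite sequence of deterministic two-party (Yao-model) protocols with output in $\mathbb{B}$; it uses $l$ guesses. $\mathrm{acc}_\Pi(x,y)=|\{i: f_{\Pi_i}(x,y)=1\}|$, $\mathrm{rej}_\Pi(x,y)=l-\mathrm{acc}_\Pi(x,y)$, where $f_{\Pi_i}$ is the function computed by $\Pi_i$. $\Pi$ computes $f$ in PP acceptance mode if $f(x,y)=1\iff \mathrm{acc}_\Pi(x,y)>\mathrm{rej}_\Pi(x,y)$. The cost of $\Pi$ is $\lceil\log l\rceil+\max_i D(\Pi_i)$, $D(\Pi_i)$ the worst-case communication of $\Pi_i$. $\mathrm{PP}(f)$ is the minimum cost of a guess protocol computing $f$ in PP acceptance mode, and $\mathcal{PP}^{cc}=\{L\mid \mathrm{PP}(L_n)=\mathrm{polylog}(n)\}$.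 BP-operator on classes: for a class $\mathcal{C}$ of languages, $L\in\mathcal{BP}\cdot\mathcal{C}$ iff there exist $L'\in\mathcal{C}$ and a polynomially bounded function $q$ such that for all $n$ and all $x,y\in\mathbb{B}^n$, with $m=\lceil q(\log n)\rceil$, the fraction of $r\in\mathbb{B}^m$ with $(\langle x,r\rangle,\langle y,r\rangle)\in L'$ is at most $1/3$ if $(x,y)\notin L$ and at least $2/3$ if $(x,y)\in L$; here $\langle\cdot,\cdot\rangle$ is a fixed pairing function on strings. $\mathcal{PH}^{cc}$: $L\in\mathcal{PH}^{cc}$ iff there exist a constant $k$ and a function $s(n)\le 2^{\mathrm{polylog}(n)}$ such that for every $n$, $L_n=\bigcup_{u_1}\bigcap_{u_2}\bigcup_{u_3}\cdots (A_{u_1\dots u_k}\times B_{u_1\dots u_k})$ with $k$ alternating unions/intersections, each index $u_i$ ranging over a set of size at most $s(n)$, and each $A_{u_1\dots u_k},B_{u_1\dots u_k}\subseteq\mathbb{B}^n$ (i.e. combinatorial rectangles at the bottom). *)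

theory Defs
  imports Complex_Main
begin

type_synonym language = "(bool list \<times> bool list) set"

definition bits :: "nat \<Rightarrow> bool list set" where
  "bits n = {x. length x = n}"

definition is_language :: "language \<Rightarrow> bool" where
  "is_language L \<longleftrightarrow> (\<forall>(x, y) \<in> L. length x = length y)"

definition slice :: "language \<Rightarrow> nat \<Rightarrow> language" where
  "slice L n = L \<inter> bits n \<times> bits n"

text \<open>All logarithms are to base 2. The bound is asymptotic, since \<open>(log n)\<^sup>c\<close> is
  degenerate for \<open>n \<le> 2\<close>.\<close>

definition polylog :: "(nat \<Rightarrow> real) \<Rightarrow> bool" where
  "polylog f \<longleftrightarrow> (\<exists>c::nat. \<forall>\<^sub>F n in sequentially. f n \<le> log 2 (real n) ^ c)"

text \<open>Deterministic protocols as binary trees: at an inner node the named player sends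
  one bit, computed from its own input, and the protocol continues in the left subtree
  on bit 0 and in the right subtree on bit 1.\<close>

datatype ('x, 'y) protocol =
    Output bool
  | Alice "'x \<Rightarrow> bool" "('x, 'y) protocol" "('x, 'y) protocol"
  | Bob "'y \<Rightarrow> bool" "('x, 'y) protocol" "('x, 'y) protocol"

primrec run :: "('x, 'y) protocol \<Rightarrow> 'x \<Rightarrow> 'y \<Rightarrow> bool" where
  "run (Output b) x y = b"
| "run (Alice a P Q) x y = (if a x then run Q x y else run P x y)"
| "run (Bob b P Q) x y = (if b y then run Q x y else run P x y)"

primrec comm :: "('x, 'y) protocol \<Rightarrow> 'x \<Rightarrow> 'y \<Rightarrow> nat" where
  "comm (Output b) x y = 0"
| "comm (Alice a P Q) x y = Suc (if a x then comm Q x y else comm P x y)"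
| "comm (Bob b P Q) x y = Suc (if b y then comm Q x y else comm P x y)"

definition worst_comm :: "'x set \<Rightarrow> 'y set \<Rightarrow> ('x, 'y) protocol \<Rightarrow> nat" where
  "worst_comm X Y P = Max ((\<lambda>(x, y). comm P x y) ` (X \<times> Y))"

type_synonym ('x, 'y) guess_protocol = "('x, 'y) protocol list"

definition acc :: "('x, 'y) guess_protocol \<Rightarrow> 'x \<Rightarrow> 'y \<Rightarrow> nat" where
  "acc Ps x y = card {i. i < length Ps \<and> run (Ps ! i) x y}"

definition rej :: "('x, 'y) guess_protocol \<Rightarrow> 'x \<Rightarrow> 'y \<Rightarrow> nat" where
  "rej Ps x y = length Ps - acc Ps x y"

definition pp_computes ::
  "'x set \<Rightarrow> 'y set \<Rightarrow> ('x, 'y) guess_protocol \<Rightarrow> ('x \<times> 'y) set \<Rightarrow> bool" where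
  "pp_computes X Y Ps F \<longleftrightarrow>
     (\<forall>x\<in>X. \<forall>y\<in>Y. (x, y) \<in> F \<longleftrightarrow> acc Ps x y > rej Ps x y)"

definition guess_cost :: "'x set \<Rightarrow> 'y set \<Rightarrow> ('x, 'y) guess_protocol \<Rightarrow> nat" where
  "guess_cost X Y Ps =
     nat \<lceil>log 2 (real (length Ps))\<rceil> + Max (worst_comm X Y ` set Ps)"

text \<open>The empty sequence is excluded because its cost is undefined.\<close>

definition PP_cost :: "'x set \<Rightarrow> 'y set \<Rightarrow> ('x \<times> 'y) set \<Rightarrow> nat" where
  "PP_cost X Y F =
     (LEAST c. \<exists>Ps. Ps \<noteq> [] \<and> pp_computes X Y Ps F \<and> guess_cost X Y Ps = c)"

definition PPcc :: "language set" where
  "PPcc = {L. is_language L \<and>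
     polylog (\<lambda>n. real (PP_cost (bits n) (bits n) (slice L n)))}"

text \<open>The pairing \<open>x\<^sub>1x\<^sub>1\<dots>x\<^sub>nx\<^sub>n01r\<close>: injective, with length depending only on
  the lengths of \<open>x\<close> and \<open>r\<close>.\<close>

definition pair_str :: "bool list \<Rightarrow> bool list \<Rightarrow> bool list" where
  "pair_str x r = concat (map (\<lambda>b. [b, b]) x) @ [False, True] @ r"

definition poly_bounded :: "(real \<Rightarrow> real) \<Rightarrow> bool" where
  "poly_bounded q \<longleftrightarrow> (\<exists>(c::real) (k::nat). \<forall>t\<ge>0. 0 \<le> q t \<and> q t \<le> c * (1 + t) ^ k)"

text \<open>Note that \<open>log 2 0 = 0\<close>, so \<open>n = 0\<close> is treated like \<open>n = 1\<close>.\<close>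

definition BP :: "language set \<Rightarrow> language set" where
  "BP C = {L. is_language L \<and>
     (\<exists>L'\<in>C. \<exists>q. poly_bounded q \<and>
       (\<forall>n. \<forall>x\<in>bits n. \<forall>y\<in>bits n.
          let m = nat \<lceil>q (log 2 (real n))\<rceil>;
              frac = real (card {r \<in> bits m. (pair_str x r, pair_str y r) \<in> L'})
                       / real (card (bits m))
          in ((x, y) \<notin> L \<longrightarrow> frac \<le> 1 / 3) \<and> ((x, y) \<in> L \<longrightarrow> frac \<ge> 2 / 3)))}"

text \<open>Alternating unions and intersections over the index sets in the list, starting
  with a union iff the flag is set; the last argument accumulates the indices
  \<open>u\<^sub>1, u\<^sub>2, \<dots>\<close> chosen so far.\<close>

fun alternation :: "bool \<Rightarrow> (nat list \<Rightarrow> 'a set) \<Rightarrow> nat set list \<Rightarrow> nat list \<Rightarrow> 'a set" where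
  "alternation b R [] us = R us"
| "alternation True R (U # Us) us = (\<Union>u\<in>U. alternation False R Us (us @ [u]))"
| "alternation False R (U # Us) us = (\<Inter>u\<in>U. alternation True R Us (us @ [u]))"

text \<open>Index sets are required to be nonempty, so that no intersection over an empty
  family leaves \<open>bits n \<times> bits n\<close>.\<close>

definition PHcc :: "language set" where
  "PHcc = {L. is_language L \<and>
     (\<exists>(k::nat) (s :: nat \<Rightarrow> nat) p. polylog p \<and> (\<forall>n. real (s n) \<le> 2 powr p n) \<and>
       (\<forall>n. \<exists>(Us :: nat set list) A B.
          length Us = k \<and>
          (\<forall>U\<in>set Us. finite U \<and> U \<noteq> {} \<and> card U \<le> s n) \<and>
          (\<forall>us. A us \<subseteq> bits n \<and> B us \<subseteq> bits n) \<and>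
          slice L n = alternation True (\<lambda>us. A us \<times> B us) Us []))}"

end

theory Submission
  imports Defs
begin

text \<open>An integer-valued function that is a signed sum of \<open>2\<^sup>e\<close> rectangle indicators gives, by
  its sign, a PP guess protocol of cost \<open>e + O(1)\<close>. A union of \<open>2\<^sup>t\<close> sets with indicators \<open>f\<^sub>u\<close>
  is represented by \<open>1 - (\<Prod>i. 1 - (\<Sum>u\<in>S\<^sub>i. f\<^sub>u))\<close> for polynomially many (in \<open>t\<close>) random sets
  \<open>S\<^sub>i\<close> of random density: as in the Valiant--Vazirani lemma, with high probability some \<open>S\<^sub>i\<close>
  contains exactly one \<open>u\<close> with \<open>f\<^sub>u = 1\<close>, and then the value is exactly 1, while it is 0 if all
  \<open>f\<^sub>u\<close> vanish. Intersections follow by complementation, and a bounded number of alternations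
  keeps \<open>e\<close> polylogarithmic. As in Newman's theorem, \<open>O(n)\<close> samples of the resulting random
  function suffice for all \<open>4\<^sup>n\<close> inputs at once, so \<open>log n + O(1)\<close> random bits do; for a fixed
  length the signed sums for the different seeds live on disjoint blocks and can be added up.\<close>

section \<open>Signed sums of rectangles\<close>

text \<open>Adding one signed rectangle at a time makes every closure property an induction.
  \<open>T\<close> counts rectangles with multiplicity, and since empty rectangles can be added it
  serves as an upper bound.\<close>

inductive rect_sum :: "nat \<Rightarrow> ('x \<times> 'y \<Rightarrow> int) \<Rightarrow> bool" where
  zero: "rect_sum 0 (\<lambda>_. 0)"
| plus: "rect_sum T f \<Longrightarrow> rect_sum (Suc T) (\<lambda>z. f z + of_bool (z \<in> A \<times> B))"
| minus: "rect_sum T f \<Longrightarrow> rect_sum (Suc T) (\<lambda>z. f z - of_bool (z \<in> A \<times> B))"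

lemma rect_sum_mono:
  assumes "rect_sum T f" "T \<le> T'"
  shows "rect_sum T' f"
  using assms(2,1)
proof (induction rule: dec_induct)
  case (step n)
  then show ?case using rect_sum.plus[of n f "{}" "{}"] by simp
qed

lemma rect_sum_rectangle: "rect_sum 1 (\<lambda>z. of_bool (z \<in> A \<times> B))"
  using rect_sum.plus[OF rect_sum.zero, of A B] by simp

lemma rect_sum_one: "rect_sum 1 (\<lambda>_. 1)"
  using rect_sum_rectangle[of UNIV UNIV] by simp

lemma rect_sum_add:
  assumes "rect_sum T f" "rect_sum T' g"
  shows "rect_sum (T + T') (\<lambda>z. f z + g z)"
  using assms(2)
proof induction
  case zero
  then show ?case using assms(1) by simp
next
  case (plus T g A B)
  show ?case using rect_sum.plus[OF plus.IH, of A B] by (simp add: add.assoc)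
next
  case (minus T g A B)
  show ?case using rect_sum.minus[OF minus.IH, of A B] by (simp add: algebra_simps)
qed

lemma rect_sum_uminus: "rect_sum T f \<Longrightarrow> rect_sum T (\<lambda>z. - f z)"
proof (induction rule: rect_sum.induct)
  case zero
  show ?case using rect_sum.zero by simp
next
  case (plus T g A B)
  show ?case using rect_sum.minus[OF plus.IH, of A B] by simp
next
  case (minus T g A B)
  show ?case using rect_sum.plus[OF minus.IH, of A B] by (simp add: algebra_simps)
qed

lemma rect_sum_diff:
  "rect_sum T f \<Longrightarrow> rect_sum T' g \<Longrightarrow> rect_sum (T + T') (\<lambda>z. f z - g z)"
  using rect_sum_add[of T f T' "\<lambda>z. - g z"] rect_sum_uminus[of T' g] by simp

lemma rect_sum_restrict:
  "rect_sum T f \<Longrightarrow> rect_sum T (\<lambda>z. f z * of_bool (z \<in> A \<times> B))"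
proof (induction rule: rect_sum.induct)
  case zero
  show ?case using rect_sum.zero by simp
next
  case (plus T g C D)
  have "(\<lambda>z. (g z + of_bool (z \<in> C \<times> D)) * of_bool (z \<in> A \<times> B))
      = (\<lambda>z. g z * of_bool (z \<in> A \<times> B) + of_bool (z \<in> (A \<inter> C) \<times> (B \<inter> D)))"
    by (auto simp: fun_eq_iff)
  then show ?case using rect_sum.plus[OF plus.IH, of "A \<inter> C" "B \<inter> D"] by (simp only:)
next
  case (minus T g C D)
  have "(\<lambda>z. (g z - of_bool (z \<in> C \<times> D)) * of_bool (z \<in> A \<times> B))
      = (\<lambda>z. g z * of_bool (z \<in> A \<times> B) - of_bool (z \<in> (A \<inter> C) \<times> (B \<inter> D)))"
    by (auto simp: fun_eq_iff)
  then show ?case using rect_sum.minus[OF minus.IH, of "A \<inter> C" "B \<inter> D"] by (simp only:)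
qed

text \<open>Distributivity: the product of two rectangle indicators is the indicator of their
  intersection, again a rectangle.\<close>

lemma rect_sum_mult:
  assumes f: "rect_sum T f" and g: "rect_sum T' g"
  shows "rect_sum (T * T') (\<lambda>z. f z * g z)"
  using g
proof induction
  case zero
  show ?case using rect_sum.zero by simp
next
  case (plus T' g A B)
  show ?case using rect_sum_add[OF rect_sum_restrict[OF f, of A B] plus.IH]
    by (simp add: algebra_simps)
next
  case (minus T' g A B)
  show ?case using rect_sum_add[OF rect_sum_uminus[OF rect_sum_restrict[OF f, of A B]] minus.IH]
    by (simp add: algebra_simps)
qed

lemma rect_sum_sum:
  assumes "finite S" "\<And>u. u \<in> S \<Longrightarrow> rect_sum T (f u)"
  shows "rect_sum (card S * T) (\<lambda>z. \<Sum>u\<in>S. f u z)"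
  using assms
proof (induction S rule: finite_induct)
  case empty
  show ?case using rect_sum.zero by simp
next
  case (insert u S)
  then show ?case using rect_sum_add[of T "f u" "card S * T" "\<lambda>z. \<Sum>u\<in>S. f u z"] by simp
qed

lemma rect_sum_prod:
  assumes "\<And>i. i < q \<Longrightarrow> rect_sum T (f i)"
  shows "rect_sum (T ^ q) (\<lambda>z. \<Prod>i<q. f i z)"
  using assms
proof (induction q)
  case 0
  show ?case using rect_sum_one by simp
next
  case (Suc q)
  then show ?case using rect_sum_mult[of "T ^ q" "\<lambda>z. \<Prod>i<q. f i z" T "f q"]
    by (simp add: mult.commute)
qed

text \<open>The preimage of a rectangle under a map acting on each side separately is a rectangle.
  This later lets each player decode its own paired string.\<close>

lemma rect_sum_comp:
  "rect_sum T f \<Longrightarrow> rect_sum T (\<lambda>z. f (map_prod g h z))"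
proof (induction rule: rect_sum.induct)
  case zero
  show ?case by (rule rect_sum.zero)
next
  case (plus T f A B)
  show ?case using rect_sum.plus[OF plus.IH, of "g -` A" "h -` B"] by (simp add: mem_Times_iff)
next
  case (minus T f A B)
  show ?case using rect_sum.minus[OF minus.IH, of "g -` A" "h -` B"] by (simp add: mem_Times_iff)
qed

section \<open>Approximation and isolation\<close>

text \<open>The minimax dual of a distribution on functions with pointwise error at most \<open>\<epsilon>\<close>; in
  this form every probabilistic choice becomes an existence statement for a fixed weighting.\<close>

definition approximable ::
  "('x \<times> 'y) set \<Rightarrow> nat \<Rightarrow> real \<Rightarrow> ('x \<times> 'y) set \<Rightarrow> bool" where
  "approximable I T \<epsilon> F \<longleftrightarrow>
     (\<forall>w. (\<forall>z\<in>I. 0 \<le> w z) \<longrightarrow>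
       (\<exists>f. rect_sum T f \<and> (\<Sum>z\<in>{z\<in>I. f z \<noteq> of_bool (z \<in> F)}. w z) \<le> \<epsilon> * (\<Sum>z\<in>I. w z)))"

lemma approximable_rectangle:
  assumes "0 \<le> \<epsilon>"
  shows "approximable I 1 \<epsilon> (A \<times> B)"
  unfolding approximable_def
proof (intro allI impI exI[of _ "\<lambda>z. of_bool (z \<in> A \<times> B)"] conjI rect_sum_rectangle)
  fix w :: "_ \<Rightarrow> real"
  assume "\<forall>z\<in>I. 0 \<le> w z"
  then show "(\<Sum>z\<in>{z\<in>I. of_bool (z \<in> A \<times> B) \<noteq> (of_bool (z \<in> A \<times> B) :: int)}. w z) \<le> \<epsilon> * (\<Sum>z\<in>I. w z)"
    using assms by (simp add: sum_nonneg)
qed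

lemma approximable_mono:
  assumes "approximable I T \<epsilon> F" "T \<le> T'" "\<epsilon> \<le> \<epsilon>'"
  shows "approximable I T' \<epsilon>' F"
  unfolding approximable_def
proof (intro allI impI)
  fix w :: "_ \<Rightarrow> real"
  assume w: "\<forall>z\<in>I. 0 \<le> w z"
  then obtain f where "rect_sum T f"
    "(\<Sum>z\<in>{z\<in>I. f z \<noteq> of_bool (z \<in> F)}. w z) \<le> \<epsilon> * (\<Sum>z\<in>I. w z)"
    using assms(1) unfolding approximable_def by blast
  moreover have "\<epsilon> * (\<Sum>z\<in>I. w z) \<le> \<epsilon>' * (\<Sum>z\<in>I. w z)"
    using w assms(3) by (intro mult_right_mono sum_nonneg) auto
  ultimately show "\<exists>f. rect_sum T' f \<and>
      (\<Sum>z\<in>{z\<in>I. f z \<noteq> of_bool (z \<in> F)}. w z) \<le> \<epsilon>' * (\<Sum>z\<in>I. w z)"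
    using rect_sum_mono[OF _ assms(2)] by (meson order_trans)
qed

lemma approximable_Compl:
  assumes "approximable I T \<epsilon> F"
  shows "approximable I (Suc T) \<epsilon> (- F)"
  unfolding approximable_def
proof (intro allI impI)
  fix w :: "_ \<Rightarrow> real"
  assume "\<forall>z\<in>I. 0 \<le> w z"
  then obtain f where f: "rect_sum T f"
    "(\<Sum>z\<in>{z\<in>I. f z \<noteq> of_bool (z \<in> F)}. w z) \<le> \<epsilon> * (\<Sum>z\<in>I. w z)"
    using assms unfolding approximable_def by blast
  have "{z\<in>I. 1 - f z \<noteq> of_bool (z \<in> - F)} = {z\<in>I. f z \<noteq> of_bool (z \<in> F)}"
    by (auto split: if_splits)
  then show "\<exists>g. rect_sum (Suc T) g \<and>
      (\<Sum>z\<in>{z\<in>I. g z \<noteq> of_bool (z \<in> - F)}. w z) \<le> \<epsilon> * (\<Sum>z\<in>I. w z)"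
    using rect_sum_diff[OF rect_sum_one f(1)] f(2) by (intro exI[of _ "\<lambda>z. 1 - f z"]) simp
qed

text \<open>If each of \<open>m\<close> further elements is picked independently with probability \<open>p\<close>, this is
  the probability that exactly one is picked in total, given that \<open>a\<close> are picked already.\<close>

definition isolation :: "real \<Rightarrow> nat \<Rightarrow> nat \<Rightarrow> real" where
  "isolation p a m =
     (if a = 0 then real m * p * (1 - p) ^ (m - 1) else if a = 1 then (1 - p) ^ m else 0)"

text \<open>Conditioning on whether the first of the \<open>Suc m\<close> undecided elements is
  picked.\<close>

lemma isolation_Suc:
  "isolation p a (Suc m) = p * isolation p (Suc a) m + (1 - p) * isolation p a m"
  by (cases m) (auto simp: isolation_def algebra_simps)

lemma convex_comb_le_max:
  fixes a b p :: real
  assumes "0 \<le> p" "p \<le> 1"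
  shows "p * a + (1 - p) * b \<le> a \<or> p * a + (1 - p) * b \<le> b"
proof (cases "b \<le> a")
  case True
  then have "(1 - p) * b \<le> (1 - p) * a" using assms by (intro mult_left_mono) auto
  then show ?thesis by (simp add: algebra_simps)
next
  case False
  then have "p * a \<le> p * b" using assms by (intro mult_left_mono) auto
  then show ?thesis by (simp add: algebra_simps)
qed

text \<open>Method of conditional expectations. \<open>C\<close> holds the elements already picked,
  \<open>U\<close> the undecided ones, and the left-hand sum is the expected isolated weight.
  Deciding one \<open>u\<close> splits it into a convex combination, so one of the two decisions
  does not decrease it.\<close>

lemma exists_subset_ge_isolation:
  fixes Z :: "'i \<Rightarrow> 'u set" and w :: "'i \<Rightarrow> real"
  assumes "finite U" "finite C" "C \<inter> U = {}" and p: "0 \<le> p" "p \<le> 1"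
  shows "\<exists>S\<subseteq>U. (\<Sum>i\<in>I. w i * isolation p (card (C \<inter> Z i)) (card (U \<inter> Z i)))
            \<le> (\<Sum>i\<in>I. w i * of_bool (card ((C \<union> S) \<inter> Z i) = 1))"
  using assms(1-3)
proof (induction U arbitrary: C rule: finite_induct)
  case empty
  show ?case
    by (intro exI[of _ "{}"]) (auto simp: isolation_def intro!: sum_mono)
next
  case (insert u U)
  define \<Phi> where "\<Phi> C U = (\<Sum>i\<in>I. w i * isolation p (card (C \<inter> Z i)) (card (U \<inter> Z i)))" for C U
  have "isolation p (card (C \<inter> Z i)) (card (insert u U \<inter> Z i))
      = p * isolation p (card (insert u C \<inter> Z i)) (card (U \<inter> Z i))
        + (1 - p) * isolation p (card (C \<inter> Z i)) (card (U \<inter> Z i))" for i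
  proof (cases "u \<in> Z i")
    case True
    then have "card (insert u U \<inter> Z i) = Suc (card (U \<inter> Z i))"
      and "card (insert u C \<inter> Z i) = Suc (card (C \<inter> Z i))"
      using insert.prems insert.hyps by auto
    then show ?thesis by (simp only: isolation_Suc)
  next
    case False
    then show ?thesis by (simp add: algebra_simps)
  qed
  then have "\<Phi> C (insert u U) = p * \<Phi> (insert u C) U + (1 - p) * \<Phi> C U"
    unfolding \<Phi>_def by (simp add: sum_distrib_left sum.distrib distrib_left mult.left_commute)
  then consider "\<Phi> C (insert u U) \<le> \<Phi> (insert u C) U" | "\<Phi> C (insert u U) \<le> \<Phi> C U"
    using convex_comb_le_max[OF p] by metis
  then show ?case
  proof cases
    case 1
    obtain S where "S \<subseteq> U"
      "\<Phi> (insert u C) U \<le> (\<Sum>i\<in>I. w i * of_bool (card ((insert u C \<union> S) \<inter> Z i) = 1))"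
      using insert.IH[of "insert u C"] insert.prems insert.hyps unfolding \<Phi>_def by auto
    then show ?thesis using 1 unfolding \<Phi>_def
      by (intro exI[of _ "insert u S"]) auto
  next
    case 2
    obtain S where "S \<subseteq> U"
      "\<Phi> C U \<le> (\<Sum>i\<in>I. w i * of_bool (card ((C \<union> S) \<inter> Z i) = 1))"
      using insert.IH[of C] insert.prems insert.hyps unfolding \<Phi>_def by auto
    then show ?thesis using 2 unfolding \<Phi>_def
      by (intro exI[of _ "S"]) auto
  qed
qed

lemma isolation_nonneg: "0 \<le> p \<Longrightarrow> p \<le> 1 \<Longrightarrow> 0 \<le> isolation p a m"
  by (auto simp: isolation_def)

text \<open>For \<open>p = 1 / 2 ^ (j + 2)\<close> the expected number \<open>m * p\<close> of picks
  lies between 1/4 and 1/2. Bernoulli's inequality bounds the chance that the other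
  \<open>m - 1\<close> elements are avoided by 1/2 from below, which gives 1/4 * 1/2.\<close>

lemma isolation_scale_ge:
  assumes "2 ^ j \<le> m" "m < 2 ^ Suc j"
  shows "1 / 8 \<le> isolation (1 / 2 ^ (j + 2)) 0 m"
proof -
  define p :: real where "p = 1 / 2 ^ (j + 2)"
  have p: "0 \<le> p" "p \<le> 1"
    using one_le_power[of "2::real" "j + 2"] by (auto simp: p_def divide_le_eq_1)
  have "(2::real) ^ j \<le> real m" "real m \<le> 2 ^ Suc j"
    using assms by (metis of_nat_le_iff of_nat_numeral of_nat_power less_imp_le)+
  then have mp: "1 / 4 \<le> real m * p" "real m * p \<le> 1 / 2"
    by (auto simp: p_def field_simps)
  have "1 / 2 \<le> 1 + real (m - 1) * (- p)"
    using mp p by (cases m) (auto simp: algebra_simps)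
  also have "\<dots> \<le> (1 - p) ^ (m - 1)"
    using Bernoulli_inequality[of "- p" "m - 1"] p by simp
  finally have "1 / 4 * (1 / 2) \<le> real m * p * (1 - p) ^ (m - 1)"
    using mp by (intro mult_mono) auto
  then show ?thesis by (simp add: isolation_def p_def)
qed

text \<open>Averages over the densities \<open>1 / 2\<^bsup>j + 2\<^esup>\<close> with \<open>j \<le> t\<close>, one of which fits the size of
  \<open>Z i\<close>.\<close>

lemma exists_isolating_set:
  fixes Z :: "'i \<Rightarrow> 'u set" and w :: "'i \<Rightarrow> real"
  assumes "finite U" "card U \<le> 2 ^ t" "\<And>i. i \<in> I \<Longrightarrow> 0 \<le> w i"
    and Z: "\<And>i. i \<in> I \<Longrightarrow> Z i \<subseteq> U \<and> Z i \<noteq> {}"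
  shows "\<exists>S\<subseteq>U. (\<Sum>i\<in>I. w i) / (8 * (real t + 1)) \<le> (\<Sum>i\<in>I. w i * of_bool (card (S \<inter> Z i) = 1))"
proof -
  define \<Phi> where "\<Phi> j = (\<Sum>i\<in>I. w i * isolation (1 / 2 ^ (j + 2)) 0 (card (Z i)))" for j :: nat
  have p: "(0::real) \<le> 1 / 2 ^ (j + 2)" "(1::real) / 2 ^ (j + 2) \<le> 1" for j :: nat
    using one_le_power[of "2::real" "j + 2"] by (auto simp: divide_le_eq_1)
  have "(\<Sum>i\<in>I. w i) / 8 = (\<Sum>i\<in>I. w i * (1 / 8))"
    by (simp add: sum_divide_distrib)
  also have "\<dots> \<le> (\<Sum>i\<in>I. w i * (\<Sum>j\<le>t. isolation (1 / 2 ^ (j + 2)) 0 (card (Z i))))"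
  proof (intro sum_mono mult_left_mono)
    fix i assume i: "i \<in> I"
    have fin: "finite (Z i)" using Z[OF i] assms(1) by (auto intro: finite_subset)
    then have "card (Z i) \<noteq> 0" using Z[OF i] by simp
    have le: "card (Z i) \<le> 2 ^ t"
      using Z[OF i] assms(1,2) card_mono[of U "Z i"] by linarith
    with \<open>card (Z i) \<noteq> 0\<close> obtain j where j: "2 ^ j \<le> card (Z i)" "card (Z i) < 2 ^ Suc j"
      using ex_power_ivl1[of 2 "card (Z i)"] by auto
    then have "(2::nat) ^ j \<le> 2 ^ t" using le by linarith
    then have "j \<le> t" by simp
    have "1 / 8 \<le> isolation (1 / 2 ^ (j + 2)) 0 (card (Z i))"
      by (rule isolation_scale_ge[OF j])
    also have "\<dots> \<le> (\<Sum>j\<le>t. isolation (1 / 2 ^ (j + 2)) 0 (card (Z i)))"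
      using \<open>j \<le> t\<close> isolation_nonneg[OF p] by (intro member_le_sum) auto
    finally show "1 / 8 \<le> (\<Sum>j\<le>t. isolation (1 / 2 ^ (j + 2)) 0 (card (Z i)))" .
  qed (use assms(3) in auto)
  also have "\<dots> = (\<Sum>j\<le>t. \<Phi> j)"
    unfolding \<Phi>_def sum_distrib_left by (rule sum.swap)
  finally have sum: "(\<Sum>i\<in>I. w i) / 8 \<le> (\<Sum>j\<le>t. \<Phi> j)" .
  \<comment> \<open>Some one of the \<open>t + 1\<close> densities reaches the average.\<close>
  obtain j where j: "(\<Sum>i\<in>I. w i) / (8 * (real t + 1)) \<le> \<Phi> j"
  proof (rule ccontr)
    assume "\<not> thesis"
    then have "(\<Sum>j\<le>t. \<Phi> j) < (\<Sum>j\<le>t. (\<Sum>i\<in>I. w i) / (8 * (real t + 1)))"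
      using that by (intro sum_strict_mono) (auto simp: not_le[symmetric])
    also have "\<dots> = (\<Sum>i\<in>I. w i) / 8" by (simp add: field_simps)
    finally show False using sum by simp
  qed
  obtain S where "S \<subseteq> U" "(\<Sum>i\<in>I. w i * isolation (1 / 2 ^ (j + 2)) (card ({} \<inter> Z i)) (card (U \<inter> Z i)))
      \<le> (\<Sum>i\<in>I. w i * of_bool (card (({} \<union> S) \<inter> Z i) = 1))"
    using exists_subset_ge_isolation[OF assms(1), of "{}" "1 / 2 ^ (j + 2)" w Z I] p by auto
  moreover have "(\<Sum>i\<in>I. w i * isolation (1 / 2 ^ (j + 2)) (card ({} \<inter> Z i)) (card (U \<inter> Z i))) = \<Phi> j"
    unfolding \<Phi>_def using Z by (intro sum.cong) (auto simp: Int_absorb1)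
  ultimately show ?thesis using j by auto
qed

text \<open>Greedy choice: each new set is taken for the weight that survives the earlier ones and
  isolates at least the fraction \<open>1 / (8 * (t + 1))\<close> of it. Indices with empty
  \<open>Z i\<close> are left out, since there is nothing to isolate.\<close>

lemma exists_isolating_sequence:
  fixes Z :: "'i \<Rightarrow> 'u set" and w :: "'i \<Rightarrow> real"
  assumes "finite U" "card U \<le> 2 ^ t" "finite I" "\<And>i. i \<in> I \<Longrightarrow> 0 \<le> w i"
    and Z: "\<And>i. i \<in> I \<Longrightarrow> Z i \<subseteq> U"
  shows "\<exists>S. (\<forall>k. S k \<subseteq> U) \<and>
    (\<Sum>i\<in>{i\<in>I. Z i \<noteq> {} \<and> (\<forall>k<q. card (S k \<inter> Z i) \<noteq> 1)}. w i)
      \<le> (1 - 1 / (8 * (real t + 1))) ^ q * (\<Sum>i\<in>I. w i)"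
proof (induction q)
  case 0
  show ?case using assms(3,4)
    by (intro exI[of _ "\<lambda>_. {}"]) (auto intro!: sum_mono2)
next
  case (Suc q)
  define c where "c = 1 - 1 / (8 * (real t + 1))"
  have "0 \<le> c" by (simp add: c_def field_simps)
  from Suc obtain S where S: "\<forall>k. S k \<subseteq> U"
    "(\<Sum>i\<in>{i\<in>I. Z i \<noteq> {} \<and> (\<forall>k<q. card (S k \<inter> Z i) \<noteq> 1)}. w i) \<le> c ^ q * (\<Sum>i\<in>I. w i)"
    unfolding c_def by auto
  define J where "J = {i\<in>I. Z i \<noteq> {} \<and> (\<forall>k<q. card (S k \<inter> Z i) \<noteq> 1)}"
  have J: "\<And>i. i \<in> J \<Longrightarrow> 0 \<le> w i" "\<And>i. i \<in> J \<Longrightarrow> Z i \<subseteq> U \<and> Z i \<noteq> {}"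
    using assms(4) Z by (auto simp: J_def)
  have "\<exists>V\<subseteq>U. (\<Sum>i\<in>J. w i) / (8 * (real t + 1)) \<le> (\<Sum>i\<in>J. w i * of_bool (card (V \<inter> Z i) = 1))"
    by (rule exists_isolating_set) (use assms(1,2) J in simp_all)
  then obtain V where V: "V \<subseteq> U"
    "(\<Sum>i\<in>J. w i) / (8 * (real t + 1)) \<le> (\<Sum>i\<in>J. w i * of_bool (card (V \<inter> Z i) = 1))"
    by (elim exE conjE) (rule that)
  have fin: "finite J" using assms(3) by (simp add: J_def)
  have eq: "{i\<in>I. Z i \<noteq> {} \<and> (\<forall>k<Suc q. card ((S(q := V)) k \<inter> Z i) \<noteq> 1)}
      = J \<inter> {i. card (V \<inter> Z i) \<noteq> 1}"
    by (auto simp: J_def less_Suc_eq)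
  have "(\<Sum>i\<in>J \<inter> {i. card (V \<inter> Z i) \<noteq> 1}. w i) = (\<Sum>i\<in>J. w i - w i * of_bool (card (V \<inter> Z i) = 1))"
    unfolding sum.inter_restrict[OF fin] by (intro sum.cong) auto
  also have "\<dots> \<le> c * (\<Sum>i\<in>J. w i)"
    using V(2) by (simp add: sum_subtractf c_def algebra_simps)
  also have "\<dots> \<le> c * (c ^ q * (\<Sum>i\<in>I. w i))"
    using S(2) \<open>0 \<le> c\<close> unfolding J_def by (intro mult_left_mono)
  finally have "(\<Sum>i\<in>{i\<in>I. Z i \<noteq> {} \<and> (\<forall>k<Suc q. card ((S(q := V)) k \<inter> Z i) \<noteq> 1)}. w i)
      \<le> c ^ Suc q * (\<Sum>i\<in>I. w i)"
    unfolding eq by (simp add: mult.assoc)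
  then show ?case using S(1) V(1) unfolding c_def[symmetric]
    by (intro exI[of _ "S(q := V)"]) auto
qed

section \<open>Unions and bounded alternations\<close>

lemma sum_UN_le:
  fixes w :: "'a \<Rightarrow> real"
  assumes "finite U" "finite I" "\<And>u. u \<in> U \<Longrightarrow> E u \<subseteq> I" "\<And>z. z \<in> I \<Longrightarrow> 0 \<le> w z"
  shows "(\<Sum>z\<in>(\<Union>u\<in>U. E u). w z) \<le> (\<Sum>u\<in>U. \<Sum>z\<in>E u. w z)"
  using assms(1,3)
proof (induction U rule: finite_induct)
  case (insert u U)
  have fin: "finite (E u)" "finite (\<Union>u\<in>U. E u)"
    using insert assms(2) by (auto intro: finite_subset)
  have "0 \<le> sum w (E u \<inter> (\<Union>u\<in>U. E u))"
    using insert.prems assms(4) by (intro sum_nonneg) auto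
  then have "sum w (E u \<union> (\<Union>u\<in>U. E u)) \<le> sum w (E u) + sum w (\<Union>u\<in>U. E u)"
    using sum_Un[OF fin, of w] by simp
  then show ?case using insert by fastforce
qed simp

text \<open>The error \<open>2 ^ t * \<epsilon>\<close> is a union bound over the points where some
  \<open>f u\<close> is wrong, and \<open>\<delta>\<close> accounts for the points that no
  \<open>S k\<close> isolates. Isolation refers to the sets \<open>F u\<close> themselves, so the
  two kinds of error can be bounded separately.\<close>

lemma approximable_UN:
  assumes "finite I" "finite U" "card U \<le> 2 ^ t" "0 \<le> \<epsilon>"
    and F: "\<And>u. u \<in> U \<Longrightarrow> approximable I T \<epsilon> (F u)"
    and q: "(1 - 1 / (8 * (real t + 1))) ^ q \<le> \<delta>"
  shows "approximable I (Suc (Suc (2 ^ t * T) ^ q)) (2 ^ t * \<epsilon> + \<delta>) (\<Union>u\<in>U. F u)"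
  unfolding approximable_def
proof (intro allI impI)
  fix w :: "_ \<Rightarrow> real"
  assume w: "\<forall>z\<in>I. 0 \<le> w z"
  define W where "W = (\<Sum>z\<in>I. w z)"
  have "0 \<le> W" unfolding W_def by (rule sum_nonneg) (use w in simp)
  have "\<forall>u\<in>U. \<exists>f. rect_sum T f \<and> (\<Sum>z\<in>{z\<in>I. f z \<noteq> of_bool (z \<in> F u)}. w z) \<le> \<epsilon> * W"
    using F w unfolding approximable_def W_def by blast
  then obtain f where "\<forall>u\<in>U. rect_sum T (f u) \<and>
      (\<Sum>z\<in>{z\<in>I. f u z \<noteq> of_bool (z \<in> F u)}. w z) \<le> \<epsilon> * W"
    by (rule bchoice[THEN exE])
  then have f: "\<And>u. u \<in> U \<Longrightarrow> rect_sum T (f u)"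
    "\<And>u. u \<in> U \<Longrightarrow> (\<Sum>z\<in>{z\<in>I. f u z \<noteq> of_bool (z \<in> F u)}. w z) \<le> \<epsilon> * W"
    by simp_all
  define Z where "Z z = {u\<in>U. z \<in> F u}" for z
  have "\<exists>S. (\<forall>k. S k \<subseteq> U) \<and>
    (\<Sum>z\<in>{z\<in>I. Z z \<noteq> {} \<and> (\<forall>k<q. card (S k \<inter> Z z) \<noteq> 1)}. w z)
      \<le> (1 - 1 / (8 * (real t + 1))) ^ q * W"
    unfolding W_def by (rule exists_isolating_sequence) (use assms w in \<open>auto simp: Z_def\<close>)
  then obtain S where "\<forall>k. S k \<subseteq> U" and S2:
    "(\<Sum>z\<in>{z\<in>I. Z z \<noteq> {} \<and> (\<forall>k<q. card (S k \<inter> Z z) \<noteq> 1)}. w z)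
      \<le> (1 - 1 / (8 * (real t + 1))) ^ q * W"
    by (elim exE conjE) (rule that)
  then have S1: "S k \<subseteq> U" for k by simp
  have fin: "finite (S k)" for k using S1 assms(2) by (rule finite_subset)
  define g where "g z = 1 - (\<Prod>k<q. 1 - (\<Sum>u\<in>S k. f u z))" for z
  have "rect_sum (Suc (2 ^ t * T)) (\<lambda>z. 1 - (\<Sum>u\<in>S k. f u z))" for k
  proof -
    have "rect_sum (card (S k) * T) (\<lambda>z. \<Sum>u\<in>S k. f u z)"
      using S1 f(1) fin by (intro rect_sum_sum) auto
    moreover have "card (S k) \<le> 2 ^ t"
      using card_mono[OF assms(2) S1] assms(3) by (rule order_trans)
    ultimately have "rect_sum (2 ^ t * T) (\<lambda>z. \<Sum>u\<in>S k. f u z)"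
      by (auto intro: rect_sum_mono)
    then show ?thesis using rect_sum_diff[OF rect_sum_one] by fastforce
  qed
  then have "rect_sum (Suc (2 ^ t * T) ^ q) (\<lambda>z. \<Prod>k<q. 1 - (\<Sum>u\<in>S k. f u z))"
    by (rule rect_sum_prod)
  from rect_sum_diff[OF rect_sum_one this] have g: "rect_sum (Suc (Suc (2 ^ t * T) ^ q)) g"
    unfolding g_def by simp
  define E where "E u = {z\<in>I. f u z \<noteq> of_bool (z \<in> F u)}" for u
  define N where "N = {z\<in>I. Z z \<noteq> {} \<and> (\<forall>k<q. card (S k \<inter> Z z) \<noteq> 1)}"
  have good: "g z = of_bool (z \<in> (\<Union>u\<in>U. F u))" if "z \<in> I" "z \<notin> (\<Union>u\<in>U. E u)" "z \<notin> N" for z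
  proof -
    \<comment> \<open>At a point where all \<open>f u\<close> are exact, the sum is a true count. If
      \<open>Z z\<close> is empty, every factor of the product is 1. Otherwise an isolating
      \<open>S k\<close> makes one factor 0, whatever integers the other factors are.\<close>
    have count: "(\<Sum>u\<in>S k. f u z) = int (card (S k \<inter> Z z))" for k
    proof -
      have "(\<Sum>u\<in>S k. f u z) = (\<Sum>u\<in>S k. of_bool (u \<in> Z z))"
        using that S1[of k] by (intro sum.cong) (auto simp: E_def Z_def)
      then show ?thesis using fin by (simp add: Int_def)
    qed
    show ?thesis
    proof (cases "Z z = {}")
      case True
      then have "z \<notin> (\<Union>u\<in>U. F u)" by (auto simp: Z_def)
      then show ?thesis using True unfolding g_def count by simp
    next
      case False
      then have "z \<in> (\<Union>u\<in>U. F u)" by (auto simp: Z_def)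
      have "\<exists>k<q. card (S k \<inter> Z z) = 1" using False that by (auto simp: N_def)
      then obtain k where "k < q" "card (S k \<inter> Z z) = 1" by blast
      then have "(\<Prod>k<q. 1 - int (card (S k \<inter> Z z))) = 0"
        by (intro prod_zero) auto
      then show ?thesis using \<open>z \<in> (\<Union>u\<in>U. F u)\<close> unfolding g_def count by simp
    qed
  qed
  have "{z\<in>I. g z \<noteq> of_bool (z \<in> (\<Union>u\<in>U. F u))} \<subseteq> (\<Union>u\<in>U. E u) \<union> N"
    using good by blast
  then have "(\<Sum>z\<in>{z\<in>I. g z \<noteq> of_bool (z \<in> (\<Union>u\<in>U. F u))}. w z) \<le> sum w ((\<Union>u\<in>U. E u) \<union> N)"
    by (rule sum_mono2[rotated]) (use assms(1,2) w in \<open>auto simp: E_def N_def\<close>)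
  also have "\<dots> \<le> sum w (\<Union>u\<in>U. E u) + sum w N"
  proof -
    have "0 \<le> sum w ((\<Union>u\<in>U. E u) \<inter> N)"
      using w by (intro sum_nonneg) (auto simp: N_def)
    moreover have "finite (\<Union>u\<in>U. E u)" "finite N" using assms(1,2) by (auto simp: E_def N_def)
    ultimately show ?thesis by (simp add: sum_Un)
  qed
  also have "sum w (\<Union>u\<in>U. E u) \<le> (\<Sum>u\<in>U. sum w (E u))"
    using w assms by (intro sum_UN_le) (auto simp: E_def)
  also have "\<dots> \<le> (\<Sum>u\<in>U. \<epsilon> * W)"
    using f(2) by (intro sum_mono) (auto simp: E_def)
  also have "\<dots> \<le> 2 ^ t * (\<epsilon> * W)"
  proof -
    have "real (card U) \<le> real (2 ^ t)" using assms(3) by (rule of_nat_mono)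
    then show ?thesis using assms(4) \<open>0 \<le> W\<close> by (simp add: mult_right_mono)
  qed
  also have "sum w N \<le> \<delta> * W"
    using S2 mult_right_mono[OF q \<open>0 \<le> W\<close>] unfolding N_def by (rule order_trans)
  finally have "(\<Sum>z\<in>{z\<in>I. g z \<noteq> of_bool (z \<in> (\<Union>u\<in>U. F u))}. w z) \<le> (2 ^ t * \<epsilon> + \<delta>) * W"
    by (simp add: algebra_simps)
  then show "\<exists>g. rect_sum (Suc (Suc (2 ^ t * T) ^ q)) g \<and>
      (\<Sum>z\<in>{z\<in>I. g z \<noteq> of_bool (z \<in> (\<Union>u\<in>U. F u))}. w z) \<le> (2 ^ t * \<epsilon> + \<delta>) * (\<Sum>z\<in>I. w z)"
    using g unfolding W_def by blast
qed

text \<open>Logarithm of the number of rectangles after \<open>k\<close> levels. The summands 2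
  leave room for an intersection, which is a complemented union of complements: each complement adds
  one rectangle and so at most one to the exponent.\<close>

primrec alternation_exponent :: "nat \<Rightarrow> nat \<Rightarrow> nat \<Rightarrow> nat" where
  "alternation_exponent t q 0 = 0"
| "alternation_exponent t q (Suc k) = (t + alternation_exponent t q k + 2) * q + 2"

lemma Suc_power2_le: "Suc (2 ^ n) \<le> 2 ^ Suc n"
  using one_le_power[of "2::nat" n] by simp

text \<open>One level turns the error \<open>\<epsilon>\<close> into
  \<open>2 ^ t * \<epsilon> + \<delta>\<close>. As \<open>\<delta>\<close> never exceeds the current
  \<open>\<epsilon>\<close>, this is at most \<open>2 ^ Suc t * \<epsilon>\<close>, for unions and,
  by De Morgan, for intersections.\<close>

lemma approximable_alternation:
  fixes A :: "nat list \<Rightarrow> 'x set" and B :: "nat list \<Rightarrow> 'y set"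
  assumes "finite I" "0 \<le> \<delta>" and q: "(1 - 1 / (8 * (real t + 1))) ^ q \<le> \<delta>"
    and "\<forall>U\<in>set Us. finite U \<and> card U \<le> 2 ^ t"
  shows "approximable I (2 ^ alternation_exponent t q (length Us)) (\<delta> * 2 ^ (Suc t * length Us))
           (alternation b (\<lambda>us. A us \<times> B us) Us us)"
  using assms(4)
proof (induction Us arbitrary: b us)
  case Nil
  show ?case using approximable_rectangle[OF assms(2)] by simp
next
  case (Cons U Us)
  define e where "e = alternation_exponent t q (length Us)"
  define \<epsilon> where "\<epsilon> = \<delta> * 2 ^ (Suc t * length Us)"
  have U: "finite U" "card U \<le> 2 ^ t" using Cons.prems by auto
  have IH: "approximable I (2 ^ e) \<epsilon> (alternation b (\<lambda>us. A us \<times> B us) Us us)" for b us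
    using Cons unfolding e_def \<epsilon>_def by simp
  have "0 \<le> \<epsilon>" using assms(2) by (simp add: \<epsilon>_def)
  have "\<delta> * 1 \<le> \<delta> * 2 ^ (Suc t * length Us)" using assms(2) by (intro mult_left_mono) auto
  then have "\<delta> \<le> \<epsilon>" by (simp add: \<epsilon>_def)
  also have "\<epsilon> \<le> 2 ^ t * \<epsilon>" using \<open>0 \<le> \<epsilon>\<close> mult_right_mono[of 1 "2 ^ t" \<epsilon>] by simp
  finally have err: "2 ^ t * \<epsilon> + \<delta> \<le> \<delta> * 2 ^ (Suc t * length (U # Us))"
    by (simp add: \<epsilon>_def power_add algebra_simps)
  have size: "Suc (Suc (2 ^ t * 2 ^ d) ^ q) \<le> 2 ^ ((t + d + 1) * q + 1)" for d :: nat
  proof -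
    have "Suc (2 ^ t * 2 ^ d) ^ q \<le> (2 ^ (t + d + 1)) ^ q"
      using Suc_power2_le[of "t + d"] by (intro power_mono) (auto simp: power_add)
    then have "Suc (Suc (2 ^ t * 2 ^ d) ^ q) \<le> Suc (2 ^ ((t + d + 1) * q))"
      by (simp only: power_mult Suc_le_mono)
    also have "\<dots> \<le> 2 ^ ((t + d + 1) * q + 1)"
      using Suc_power2_le by (metis Suc_eq_plus1)
    finally show ?thesis .
  qed
  show ?case
  proof (cases b)
    case True
    have "(2::nat) ^ ((t + e + 1) * q + 1) \<le> 2 ^ ((t + e + 2) * q + 2)"
      by (intro power_increasing add_mono mult_right_mono) auto
    with size[of e] have "Suc (Suc (2 ^ t * 2 ^ e) ^ q) \<le> 2 ^ alternation_exponent t q (length (U # Us))"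
      unfolding e_def by simp
    from approximable_mono[OF approximable_UN[OF assms(1) U \<open>0 \<le> \<epsilon>\<close> IH q] this err]
    show ?thesis using True by simp
  next
    case False
    have "approximable I (2 ^ Suc e) \<epsilon> (- alternation True (\<lambda>us. A us \<times> B us) Us us)" for us
      by (rule approximable_mono[OF approximable_Compl[OF IH] Suc_power2_le order_refl])
    note compl = approximable_Compl[OF approximable_UN[OF assms(1) U \<open>0 \<le> \<epsilon>\<close> this q]]
    have "Suc (Suc (Suc (2 ^ t * 2 ^ Suc e) ^ q)) \<le> Suc (2 ^ ((t + e + 2) * q + 1))"
      using size[of "Suc e"] by simp
    also have "\<dots> \<le> 2 ^ alternation_exponent t q (length (U # Us))"
      using Suc_power2_le[of "(t + e + 2) * q + 1"] by (simp add: e_def)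
    finally show ?thesis using approximable_mono[OF compl _ err] False by simp
  qed
qed

section \<open>Few seeds suffice\<close>

text \<open>Seeds are fixed one at a time, keeping the exponential moment of the number of errors
  small; each new seed at most doubles it.\<close>

lemma exists_low_error_family:
  assumes "finite I" "finite R" and F: "approximable I T (1 / 64) F"
  shows "\<exists>f. (\<forall>r\<in>R. rect_sum T (f r)) \<and>
    (\<Sum>z\<in>I. 64 ^ card {r\<in>R. f r z \<noteq> of_bool (z \<in> F)}) \<le> real (card I) * 2 ^ card R"
  using assms(2)
proof (induction R rule: finite_induct)
  case empty
  show ?case by simp
next
  case (insert r R)
  then obtain f where f: "\<forall>r\<in>R. rect_sum T (f r)"
    "(\<Sum>z\<in>I. 64 ^ card {r\<in>R. f r z \<noteq> of_bool (z \<in> F)}) \<le> real (card I) * 2 ^ card R"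
    by blast
  define w :: "_ \<Rightarrow> real" where "w z = 64 ^ card {r\<in>R. f r z \<noteq> of_bool (z \<in> F)}" for z
  have "\<forall>z\<in>I. 0 \<le> w z" by (simp add: w_def)
  then obtain g where g: "rect_sum T g"
    "(\<Sum>z\<in>{z\<in>I. g z \<noteq> of_bool (z \<in> F)}. w z) \<le> 1 / 64 * (\<Sum>z\<in>I. w z)"
    using F unfolding approximable_def by blast
  define h where "h = f(r := g)"
  have bad: "(64::real) ^ card {r'\<in>insert r R. h r' z \<noteq> of_bool (z \<in> F)}
      = w z + 63 * (if g z \<noteq> of_bool (z \<in> F) then w z else 0)" for z
  proof -
    have *: "{r'\<in>insert r R. h r' z \<noteq> of_bool (z \<in> F)}
        = (if g z \<noteq> of_bool (z \<in> F) then insert r else id) {r\<in>R. f r z \<noteq> of_bool (z \<in> F)}"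
      using insert.hyps(2) by (auto simp: h_def)
    show ?thesis unfolding * using insert.hyps by (simp add: w_def)
  qed
  have "(\<Sum>z\<in>I. 64 ^ card {r'\<in>insert r R. h r' z \<noteq> of_bool (z \<in> F)})
      = (\<Sum>z\<in>I. w z) + 63 * (\<Sum>z\<in>{z\<in>I. g z \<noteq> of_bool (z \<in> F)}. w z)"
    unfolding bad sum.distrib sum_distrib_left[symmetric]
    using assms(1) by (simp add: sum.If_cases Int_def)
  \<comment> \<open>A wrong value multiplies the weight by 64, that is, adds 63 times the weight;
    the wrong points carry at most 1/64 of the total, and 1 + 63/64 is below 2.\<close>
  also have "\<dots> \<le> 2 * (\<Sum>z\<in>I. w z)"
    using g(2) sum_nonneg[of I w] by (simp add: w_def)
  also have "\<dots> \<le> real (card I) * 2 ^ card (insert r R)"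
    using f(2) insert.hyps unfolding w_def[symmetric] by simp
  finally show ?case using f(1) g(1)
    by (intro exI[of _ h]) (auto simp: h_def)
qed

text \<open>The moment is at most \<open>4 ^ card R\<close>, and a point with \<open>c\<close>
  errors contributes \<open>64 ^ c = 4 ^ (3 * c)\<close>, so \<open>3 * c \<le> card R\<close>. The
  base 64 = 4 ^ 3 is what yields the error fraction 1/3.\<close>

lemma exists_low_error_seeds:
  assumes "finite I" "finite R" "card I \<le> 2 ^ card R" "approximable I T (1 / 64) F"
  shows "\<exists>f. (\<forall>r\<in>R. rect_sum T (f r)) \<and>
    (\<forall>z\<in>I. 3 * card {r\<in>R. f r z \<noteq> of_bool (z \<in> F)} \<le> card R)"
proof -
  obtain f where f: "\<forall>r\<in>R. rect_sum T (f r)"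
    "(\<Sum>z\<in>I. 64 ^ card {r\<in>R. f r z \<noteq> of_bool (z \<in> F)}) \<le> real (card I) * 2 ^ card R"
    using exists_low_error_family[OF assms(1,2,4)] by blast
  have "3 * card {r\<in>R. f r z \<noteq> of_bool (z \<in> F)} \<le> card R" if "z \<in> I" for z
  proof -
    define c where "c = card {r\<in>R. f r z \<noteq> of_bool (z \<in> F)}"
    have "(4::real) ^ (3 * c) = 64 ^ c" by (simp add: power_mult)
    also have "\<dots> \<le> (\<Sum>z\<in>I. 64 ^ card {r\<in>R. f r z \<noteq> of_bool (z \<in> F)})"
      unfolding c_def using that assms(1)
      by (intro member_le_sum[of z I "\<lambda>z. 64 ^ card {r\<in>R. f r z \<noteq> of_bool (z \<in> F)}"]) auto
    also have "\<dots> \<le> real (card I) * 2 ^ card R" by (rule f(2))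
    also have "\<dots> \<le> 2 ^ card R * 2 ^ card R"
    proof -
      have "real (card I) \<le> real (2 ^ card R)" using assms(3) by (rule of_nat_mono)
      then show ?thesis by (intro mult_right_mono) auto
    qed
    also have "\<dots> = 4 ^ card R" by (simp flip: power_mult_distrib)
    finally show ?thesis unfolding c_def[symmetric] by simp
  qed
  with f(1) show ?thesis by blast
qed

section \<open>Guess protocols from signed sums\<close>

text \<open>This is \<open>acc\<close> minus \<open>rej\<close> as an integer, written as a sum over
  the list so that it is additive when protocols are prepended.\<close>

definition balance :: "('x, 'y) guess_protocol \<Rightarrow> 'x \<Rightarrow> 'y \<Rightarrow> int" where
  "balance Ps x y = (\<Sum>P\<leftarrow>Ps. if run P x y then 1 else - 1)"

lemma acc_gt_rej_iff: "acc Ps x y > rej Ps x y \<longleftrightarrow> balance Ps x y > 0"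
proof -
  define n where "n = length (filter (\<lambda>P. run P x y) Ps)"
  have "acc Ps x y = n"
    by (simp add: acc_def n_def length_filter_conv_card)
  moreover have "n \<le> length Ps" by (simp add: n_def)
  moreover have "balance Ps x y = 2 * int n - int (length Ps)"
    unfolding balance_def n_def by (induction Ps) auto
  ultimately show ?thesis unfolding rej_def by linarith
qed

text \<open>A membership test for a rectangle contributes twice its indicator minus 1, and a
  constant protocol cancels the 1. Hence two protocols per rectangle and the factor 2; negative
  signs swap the outputs. Two cancelling constants start the list and keep it nonempty.\<close>

lemma rect_sum_guess_protocol:
  assumes "rect_sum T f"
  shows "\<exists>Ps. length Ps = 2 * T + 2 \<and> (\<forall>P\<in>set Ps. \<forall>x y. comm P x y \<le> 2) \<and>
     (\<forall>x y. balance Ps x y = 2 * f (x, y))"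
  using assms
proof induction
  case zero
  show ?case by (intro exI[of _ "[Output True, Output False]"]) (auto simp: balance_def)
next
  case (plus T f A B)
  then obtain Ps where Ps: "length Ps = 2 * T + 2" "\<forall>P\<in>set Ps. \<forall>x y. comm P x y \<le> 2"
    "\<forall>x y. balance Ps x y = 2 * f (x, y)" by blast
  let ?P = "Alice (\<lambda>x. x \<in> A) (Output False) (Bob (\<lambda>y. y \<in> B) (Output False) (Output True))"
  show ?case using Ps
    by (intro exI[of _ "Output True # ?P # Ps"]) (auto simp: balance_def)
next
  case (minus T f A B)
  then obtain Ps where Ps: "length Ps = 2 * T + 2" "\<forall>P\<in>set Ps. \<forall>x y. comm P x y \<le> 2"
    "\<forall>x y. balance Ps x y = 2 * f (x, y)" by blast
  let ?P = "Alice (\<lambda>x. x \<in> A) (Output True) (Bob (\<lambda>y. y \<in> B) (Output True) (Output False))"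
  show ?case using Ps
    by (intro exI[of _ "Output False # ?P # Ps"]) (auto simp: balance_def)
qed

text \<open>The list has \<open>2 * 2 ^ e + 2 \<le> 2 ^ (e + 2)\<close> protocols, so the guesses
  cost at most \<open>e + 2\<close>; the remaining 2 is one bit from each player.\<close>

lemma PP_cost_le:
  assumes "finite X" "X \<noteq> {}" "finite Y" "Y \<noteq> {}" "rect_sum (2 ^ e) f"
    and F: "\<And>x y. x \<in> X \<Longrightarrow> y \<in> Y \<Longrightarrow> (x, y) \<in> F \<longleftrightarrow> f (x, y) > 0"
  shows "PP_cost X Y F \<le> e + 4"
proof -
  obtain Ps where Ps: "length Ps = 2 * 2 ^ e + 2" "\<forall>P\<in>set Ps. \<forall>x y. comm P x y \<le> 2"
    "\<forall>x y. balance Ps x y = 2 * f (x, y)"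
    using rect_sum_guess_protocol[OF assms(5)] by blast
  have "pp_computes X Y Ps F"
    unfolding pp_computes_def acc_gt_rej_iff using Ps(3) F by simp
  moreover have "Ps \<noteq> []" using Ps(1) by auto
  ultimately have "PP_cost X Y F \<le> guess_cost X Y Ps"
    unfolding PP_cost_def by (intro Least_le) blast
  also have "\<dots> \<le> (e + 2) + 2"
    unfolding guess_cost_def
  proof (rule add_mono)
    have "length Ps \<le> 2 ^ (e + 2)" using one_le_power[of "2::nat" e] Ps(1) by simp
    then have "real (length Ps) \<le> 2 ^ (e + 2)"
      by (metis of_nat_le_iff of_nat_numeral of_nat_power)
    then have "log 2 (real (length Ps)) \<le> log 2 (2 ^ (e + 2))"
      using \<open>Ps \<noteq> []\<close> by (intro log_mono) auto
    also have "\<dots> = real (e + 2)" by (simp only: log_nat_power) simp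
    finally show "nat \<lceil>log 2 (real (length Ps))\<rceil> \<le> e + 2" by (simp add: nat_le_iff ceiling_le_iff)
    have "worst_comm X Y P \<le> 2" if "P \<in> set Ps" for P
      unfolding worst_comm_def using assms(1-4) Ps(2) that by (subst Max_le_iff) auto
    then show "Max (worst_comm X Y ` set Ps) \<le> 2"
      using \<open>Ps \<noteq> []\<close> by (subst Max_le_iff) auto
  qed
  finally show ?thesis by simp
qed

section \<open>Polylogarithmic bounds\<close>

lemma eventually_log_ge: "\<forall>\<^sub>F n in sequentially. C \<le> log 2 (real n)"
proof -
  have "C \<le> log 2 (real n)" if "nat \<lceil>2 powr C\<rceil> \<le> n" for n
  proof -
    have "2 powr C \<le> real n" using that by linarith
    moreover from this have "0 < real n" using powr_gt_zero[of 2 C] by linarith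
    ultimately show ?thesis by (subst le_log_iff) auto
  qed
  then show ?thesis unfolding eventually_sequentially by blast
qed

lemma polylog_mono:
  assumes "polylog g" "\<forall>\<^sub>F n in sequentially. f n \<le> g n"
  shows "polylog f"
proof -
  obtain c where "\<forall>\<^sub>F n in sequentially. g n \<le> log 2 (real n) ^ c"
    using assms(1) unfolding polylog_def by blast
  with assms(2) have "\<forall>\<^sub>F n in sequentially. f n \<le> log 2 (real n) ^ c"
    by eventually_elim (rule order_trans)
  then show ?thesis unfolding polylog_def by blast
qed

lemma polylog_log: "polylog (\<lambda>n. log 2 (real n))"
  unfolding polylog_def by (intro exI[of _ 1]) simp

lemma polylog_const: "polylog (\<lambda>_. C)"
  by (rule polylog_mono[OF polylog_log eventually_log_ge])

lemma polylog_add: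
  assumes "polylog f" "polylog g"
  shows "polylog (\<lambda>n. f n + g n)"
proof -
  obtain c d where "\<forall>\<^sub>F n in sequentially. f n \<le> log 2 (real n) ^ c"
    "\<forall>\<^sub>F n in sequentially. g n \<le> log 2 (real n) ^ d"
    using assms unfolding polylog_def by blast
  \<comment> \<open>Once the logarithm is at least 2, one extra power absorbs the factor 2.\<close>
  with eventually_log_ge[of 2]
  have "\<forall>\<^sub>F n in sequentially. f n + g n \<le> log 2 (real n) ^ Suc (c + d)"
  proof eventually_elim
    case (elim n)
    define l where "l = log 2 (real n)"
    have "2 \<le> l" using elim by (simp add: l_def)
    have "f n \<le> l ^ (c + d)" "g n \<le> l ^ (c + d)"
      using elim power_increasing[of c "c + d" l] power_increasing[of d "c + d" l] \<open>2 \<le> l\<close>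
      unfolding l_def by linarith+
    then have "f n + g n \<le> 2 * l ^ (c + d)" by simp
    also have "\<dots> \<le> l * l ^ (c + d)" using \<open>2 \<le> l\<close> by (intro mult_right_mono) auto
    finally show ?case by (simp add: l_def)
  qed
  then show ?thesis unfolding polylog_def by blast
qed

lemma polylog_mult:
  assumes "polylog f" "polylog g" "\<And>n. 0 \<le> f n" "\<And>n. 0 \<le> g n"
  shows "polylog (\<lambda>n. f n * g n)"
proof -
  obtain c d where "\<forall>\<^sub>F n in sequentially. f n \<le> log 2 (real n) ^ c"
    "\<forall>\<^sub>F n in sequentially. g n \<le> log 2 (real n) ^ d"
    using assms unfolding polylog_def by blast
  then have "\<forall>\<^sub>F n in sequentially. f n * g n \<le> log 2 (real n) ^ (c + d)"
  proof eventually_elim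
    case (elim n)
    have "0 \<le> log 2 (real n) ^ c" using elim(1) assms(3)[of n] by linarith
    then show ?case using elim assms(3,4) unfolding power_add by (intro mult_mono)
  qed
  then show ?thesis unfolding polylog_def by blast
qed

lemma polylog_nat_ceiling:
  assumes "polylog f"
  shows "polylog (\<lambda>n. real (nat \<lceil>f n\<rceil>))"
proof -
  obtain c where "\<forall>\<^sub>F n in sequentially. f n \<le> log 2 (real n) ^ c"
    using assms unfolding polylog_def by blast
  with eventually_log_ge[of 0]
  have le: "\<forall>\<^sub>F n in sequentially. real (nat \<lceil>f n\<rceil>) \<le> log 2 (real n) ^ c + 1"
  proof eventually_elim
    case (elim n)
    then have "0 \<le> log 2 (real n) ^ c" by simp
    with elim show ?case by linarith
  qed
  have "polylog (\<lambda>n. log 2 (real n) ^ c)" unfolding polylog_def by (intro exI[of _ c]) simp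
  from polylog_mono[OF polylog_add[OF this polylog_const] le] show ?thesis .
qed

text \<open>Needed because the protocol for strings of length \<open>N\<close> adds up the blocks
  for all \<open>n \<le> N\<close>. Monotonicity of the logarithm handles large indices, and the
  constant \<open>C\<close> the finitely many early ones.\<close>

lemma polylog_running_max:
  fixes g :: "nat \<Rightarrow> nat"
  assumes "polylog (\<lambda>n. real (g n))"
  shows "polylog (\<lambda>n. real (Max (g ` {..n})))"
proof -
  obtain c n0 where c: "\<And>n. n \<ge> n0 \<Longrightarrow> real (g n) \<le> log 2 (real n) ^ c"
    using assms unfolding polylog_def eventually_sequentially by blast
  define C where "C = Max (g ` {..n0})"
  have le: "\<forall>\<^sub>F n in sequentially. real (Max (g ` {..n})) \<le> log 2 (real n) ^ c + real C"
    using eventually_log_ge[of 0]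
  proof eventually_elim
    case (elim n)
    have "Max (g ` {..n}) \<in> g ` {..n}" by (intro Max_in) auto
    then obtain i where i: "Max (g ` {..n}) = g i" "i \<in> {..n}" by (rule imageE)
    show ?case
    proof (cases "i \<le> n0")
      case True
      then have "g i \<le> C" unfolding C_def by (intro Max_ge) auto
      moreover have "0 \<le> log 2 (real n) ^ c" using elim by simp
      ultimately show ?thesis using i by simp
    next
      case False
      then have "real (g i) \<le> log 2 (real i) ^ c" by (intro c) simp
      also have "\<dots> \<le> log 2 (real n) ^ c"
        using False i by (intro power_mono log_mono) auto
      finally show ?thesis using i by simp
    qed
  qed
  have "polylog (\<lambda>n. log 2 (real n) ^ c)" unfolding polylog_def by (intro exI[of _ c]) simp
  from polylog_mono[OF polylog_add[OF this polylog_const] le] show ?thesis .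
qed

lemma polylog_alternation_exponent:
  assumes "polylog (\<lambda>n. real (t n))" "polylog (\<lambda>n. real (q n))"
  shows "polylog (\<lambda>n. real (alternation_exponent (t n) (q n) k))"
proof (induction k)
  case 0
  show ?case by (simp add: polylog_const)
next
  case (Suc k)
  have "polylog (\<lambda>n. (real (t n) + real (alternation_exponent (t n) (q n) k) + 2) * real (q n) + 2)"
    by (intro polylog_add polylog_mult polylog_const assms Suc) auto
  then show ?case by (simp only: alternation_exponent.simps of_nat_add of_nat_mult of_nat_numeral)
qed

lemma one_minus_inverse_power_le:
  assumes "0 < N"
  shows "(1 - 1 / real N) ^ (N * j) \<le> (1 / 2) ^ j"
proof -
  have "(1 - 1 / real N) ^ N \<le> exp (- 1 / real N) ^ N"
    using assms exp_ge_add_one_self[of "- 1 / real N"] by (intro power_mono) auto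
  also have "\<dots> = exp (- 1)" using assms by (simp flip: exp_of_nat_mult)
  also have "\<dots> \<le> 1 / 2"
    using exp_ge_add_one_self[of "1::real"] by (simp add: exp_minus field_simps)
  finally have "((1 - 1 / real N) ^ N) ^ j \<le> (1 / 2) ^ j"
    using assms by (intro power_mono) auto
  then show ?thesis by (simp add: power_mult)
qed

section \<open>The BP operator\<close>

lemma finite_bits: "finite (bits n)"
  using finite_lists_length_eq[of "UNIV :: bool set" n] by (simp add: bits_def)

lemma card_bits: "card (bits n) = 2 ^ n"
  using card_lists_length_eq[of "UNIV :: bool set" n] by (simp add: bits_def)

lemma bits_nonempty: "bits n \<noteq> {}"
  using card_bits[of n] by force

lemma length_pair_str: "length (pair_str x r) = 2 * length x + 2 + length r"
  by (induction x) (auto simp: pair_str_def)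

text \<open>Read in steps of two bits, the doubled part consists of equal pairs, so the first
  unequal pair is the separator and marks where \<open>x\<close> ends.\<close>

lemma pair_str_eq_iff: "pair_str x r = pair_str y s \<longleftrightarrow> x = y \<and> r = s"
proof (induction x arbitrary: y)
  case Nil
  show ?case by (cases y) (auto simp: pair_str_def)
next
  case (Cons b x)
  then show ?case by (cases y) (auto simp: pair_str_def)
qed

text \<open>The length that the BP operator assigns to \<open>q t = t + 2\<close>. The summand 2
  makes the number of seeds at least \<open>4 * n\<close>, enough both for the \<open>4 ^ n\<close>
  inputs in the choice of seeds and for counting the lengths up to \<open>n\<close>.\<close>

definition seed_length :: "nat \<Rightarrow> nat" where
  "seed_length n = nat \<lceil>log 2 (real n) + 2\<rceil>"

lemma polylog_seed_length: "polylog (\<lambda>n. real (seed_length n))"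
  unfolding seed_length_def by (intro polylog_nat_ceiling polylog_add polylog_log polylog_const)

lemma seed_length_mono:
  assumes "n \<le> n'"
  shows "seed_length n \<le> seed_length n'"
proof (cases "n = 0")
  case True
  \<comment> \<open>By the default \<open>log 2 0 = 0\<close>, \<open>seed_length 0\<close> is 2,
    the least value taken.\<close>
  have "0 \<le> log 2 (real n')" by (cases "n' = 0") (simp add: log_def, simp)
  moreover have "log 2 (0::real) = 0" by (simp add: log_def)
  ultimately show ?thesis using True unfolding seed_length_def by (intro nat_mono ceiling_mono) auto
next
  case False
  then show ?thesis using assms unfolding seed_length_def
    by (intro nat_mono ceiling_mono add_mono log_mono) auto
qed

lemma four_times_le_power_seed_length: "4 * n \<le> 2 ^ seed_length n"
proof (cases "n = 0")
  case False
  have "real (4 * n) = 2 powr (log 2 (real n) + 2)"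
    using False by (simp add: powr_add)
  also have "\<dots> \<le> 2 powr real (seed_length n)"
    unfolding seed_length_def by (intro powr_mono) linarith+
  finally show ?thesis by (simp add: powr_realpow) (metis of_nat_le_iff of_nat_mult of_nat_numeral of_nat_power)
qed simp

text \<open>The witness language for the BP operator. Both strings must carry the same seed, so
  every pair lies in at most one block given by \<open>n\<close> and \<open>r\<close>, and within a
  block the sign of a single signed sum decides.\<close>

definition seeded_language ::
  "(nat \<Rightarrow> nat) \<Rightarrow> (nat \<Rightarrow> bool list \<Rightarrow> bool list \<times> bool list \<Rightarrow> int) \<Rightarrow> language" where
  "seeded_language m f = {(pair_str x r, pair_str y r) | n x y r.
     x \<in> bits n \<and> y \<in> bits n \<and> r \<in> bits (m n) \<and> f n r (x, y) > 0}"

lemma pair_str_in_seeded_language: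
  assumes "x \<in> bits n" "r \<in> bits (m n)"
  shows "(pair_str x r, pair_str y r) \<in> seeded_language m f \<longleftrightarrow> y \<in> bits n \<and> f n r (x, y) > 0"
  using assms by (auto simp: seeded_language_def pair_str_eq_iff bits_def)

text \<open>Summing over all \<open>n \<le> N\<close> and all seeds avoids determining which
  \<open>n\<close> fits the length \<open>N\<close>. The blocks are disjoint by injectivity of the
  pairing, so at most one summand is nonzero at any point. There are at most
  \<open>(N + 1) * 2 ^ seed_length N\<close> blocks, whence twice the seed length.\<close>

lemma PP_cost_seeded_language_le:
  assumes f: "\<And>n r. r \<in> bits (seed_length n) \<Longrightarrow> rect_sum (2 ^ e n) (f n r)"
  shows "PP_cost (bits N) (bits N) (slice (seeded_language seed_length f) N)
           \<le> 2 * seed_length N + Max (e ` {..N}) + 4"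
proof -
  define E where "E = Max (e ` {..N})"
  define K where "K = (SIGMA n:{..N}. bits (seed_length n))"
  define P where "P n r = (\<lambda>x. pair_str x r) ` bits n" for n r
  define dec where "dec r = inv (\<lambda>x. pair_str x r)" for r
  have dec: "dec r (pair_str x r) = x" for r x
    unfolding dec_def by (rule inv_f_f) (auto simp: inj_def pair_str_eq_iff)
  \<comment> \<open>The decoder \<open>dec r\<close> is meaningful only on strings paired with
    \<open>r\<close>; restricting to the block removes all other arguments.\<close>
  define h where "h = (\<lambda>(n, r) z. f n r (map_prod (dec r) (dec r) z) * of_bool (z \<in> P n r \<times> P n r))"
  define g where "g z = (\<Sum>k\<in>K. h k z)" for z
  have "finite K" by (simp add: K_def finite_bits)
  have h: "rect_sum (2 ^ E) (h k)" if "k \<in> K" for k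
  proof -
    obtain n r where "k = (n, r)" by (cases k)
    with that have k: "k = (n, r)" "n \<le> N" "r \<in> bits (seed_length n)"
      by (auto simp: K_def)
    then have "e n \<le> E" unfolding E_def by (intro Max_ge) auto
    then have "rect_sum (2 ^ E) (f n r)" using f[OF k(3)] by (auto intro: rect_sum_mono)
    then show ?thesis unfolding h_def k(1) prod.case
      by (intro rect_sum_restrict rect_sum_comp)
  qed
  have "card K = (\<Sum>n\<le>N. 2 ^ seed_length n)"
    unfolding K_def by (simp add: card_SigmaI finite_bits card_bits)
  also have "\<dots> \<le> (\<Sum>n\<le>N. 2 ^ seed_length N)"
    by (intro sum_mono power_increasing seed_length_mono) auto
  also have "\<dots> = Suc N * 2 ^ seed_length N" by simp
  also have "\<dots> \<le> 2 ^ seed_length N * 2 ^ seed_length N"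
  proof -
    have "Suc N \<le> 2 ^ seed_length N"
      using four_times_le_power_seed_length[of N] by (cases "N = 0") auto
    then show ?thesis by (rule mult_right_mono) simp
  qed
  finally have "card K * 2 ^ E \<le> 2 ^ seed_length N * 2 ^ seed_length N * 2 ^ E"
    by (rule mult_right_mono) simp
  also have "\<dots> = 2 ^ (2 * seed_length N + E)"
    by (simp add: power_add mult_2)
  finally have g: "rect_sum (2 ^ (2 * seed_length N + E)) g"
    using rect_sum_sum[OF \<open>finite K\<close> h] unfolding g_def by (rule rect_sum_mono[rotated])
  have "(x', y') \<in> slice (seeded_language seed_length f) N \<longleftrightarrow> g (x', y') > 0"
    if "x' \<in> bits N" "y' \<in> bits N" for x' y'
  proof (cases "\<exists>(n, r)\<in>K. (x', y') \<in> P n r \<times> P n r")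
    case True
    then obtain n r x y where k: "(n, r) \<in> K" and x: "x \<in> bits n" "x' = pair_str x r"
      and y: "y \<in> bits n" "y' = pair_str y r"
      unfolding P_def by auto
    have "h k (x', y') = 0" if "k \<in> K - {(n, r)}" for k
      using that x by (cases k) (auto simp: h_def P_def pair_str_eq_iff bits_def)
    then have "g (x', y') = h (n, r) (x', y')"
      unfolding g_def using \<open>finite K\<close> k by (simp add: sum.remove)
    also have "\<dots> = f n r (x, y)"
      using x y by (simp add: h_def P_def dec)
    finally show ?thesis
      using pair_str_in_seeded_language[of x n r seed_length y f] k x y that
      by (auto simp: slice_def K_def)
  next
    case False
    then have "g (x', y') = 0" unfolding g_def h_def
      by (intro sum.neutral) auto
    moreover have "(x', y') \<notin> seeded_language seed_length f"
    proof
      assume "(x', y') \<in> seeded_language seed_length f"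
      then obtain n r x y where *: "x \<in> bits n" "y \<in> bits n" "r \<in> bits (seed_length n)"
        "x' = pair_str x r" "y' = pair_str y r"
        by (auto simp: seeded_language_def)
      then have "n \<le> N" using \<open>x' \<in> bits N\<close> by (auto simp: bits_def length_pair_str)
      with * False show False by (auto simp: K_def P_def)
    qed
    ultimately show ?thesis by (simp add: slice_def)
  qed
  then show ?thesis unfolding E_def[symmetric]
    by (intro PP_cost_le[OF finite_bits bits_nonempty finite_bits bits_nonempty g])
qed

lemma seeded_language_in_PPcc:
  assumes f: "\<And>n r. r \<in> bits (seed_length n) \<Longrightarrow> rect_sum (2 ^ e n) (f n r)"
    and "polylog (\<lambda>n. real (e n))"
  shows "seeded_language seed_length f \<in> PPcc"
proof -
  have bound: "polylog (\<lambda>N. 2 * real (seed_length N) + real (Max (e ` {..N})) + 4)"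
    by (intro polylog_add polylog_mult polylog_const polylog_seed_length
        polylog_running_max assms(2)) auto
  have "real (PP_cost (bits N) (bits N) (slice (seeded_language seed_length f) N))
      \<le> 2 * real (seed_length N) + real (Max (e ` {..N})) + 4" for N
    using PP_cost_seeded_language_le[where N = N and e = e and f = f, OF f] by linarith
  then have "polylog (\<lambda>N. real (PP_cost (bits N) (bits N) (slice (seeded_language seed_length f) N)))"
    by (rule polylog_mono[OF bound always_eventually[OF allI]])
  moreover have "is_language (seeded_language seed_length f)"
    by (auto simp: is_language_def seeded_language_def length_pair_str bits_def)
  ultimately show ?thesis by (simp add: PPcc_def)
qed

section \<open>From the hierarchy to the BP operator\<close>

lemma PHcc_approximable:
  assumes "L \<in> PHcc"
  shows "\<exists>e. polylog (\<lambda>n. real (e n)) \<and>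
    (\<forall>n. approximable (bits n \<times> bits n) (2 ^ e n) (1 / 64) (slice L n))"
proof -
  obtain k :: nat and s :: "nat \<Rightarrow> nat" and p where p: "polylog p"
    and s: "\<forall>n. real (s n) \<le> 2 powr p n"
    and L: "\<forall>n. \<exists>(Us :: nat set list) A B. length Us = k \<and>
          (\<forall>U\<in>set Us. finite U \<and> U \<noteq> {} \<and> card U \<le> s n) \<and>
          (\<forall>us. A us \<subseteq> bits n \<and> B us \<subseteq> bits n) \<and>
          slice L n = alternation True (\<lambda>us. A us \<times> B us) Us []"
    using assms unfolding PHcc_def mem_Collect_eq by (elim exE conjE) (rule that)
  \<comment> \<open>Index sets have size at most \<open>2 ^ t n\<close>. Starting from error
    \<open>(1 / 2) ^ j n\<close>, the growth by \<open>2 ^ (Suc (t n) * k)\<close> over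
    \<open>k\<close> levels leaves \<open>2 ^ -6\<close>, that is 1/64. The number
    \<open>q n\<close> of isolating sets brings the failure of one union down to
    \<open>(1 / 2) ^ j n\<close>.\<close>
  define t where "t n = nat \<lceil>p n\<rceil>" for n
  define j where "j n = Suc (t n) * k + 6" for n
  define q where "q n = 8 * Suc (t n) * j n" for n
  define e where "e n = alternation_exponent (t n) (q n) k" for n
  have t: "polylog (\<lambda>n. real (t n))" unfolding t_def by (rule polylog_nat_ceiling[OF p])
  have "polylog (\<lambda>n. 8 * (real (t n) + 1) * ((real (t n) + 1) * real k + 6))"
    by (intro polylog_add polylog_mult polylog_const t) auto
  then have "polylog (\<lambda>n. real (q n))" unfolding q_def j_def by (simp add: algebra_simps)
  then have "polylog (\<lambda>n. real (e n))"
    unfolding e_def by (intro polylog_alternation_exponent t)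
  moreover have "approximable (bits n \<times> bits n) (2 ^ e n) (1 / 64) (slice L n)" for n
  proof -
    obtain Us :: "nat set list" and A B where Us: "length Us = k"
      "\<forall>U\<in>set Us. finite U \<and> U \<noteq> {} \<and> card U \<le> s n"
      "slice L n = alternation True (\<lambda>us. A us \<times> B us) Us []"
      using L[rule_format, of n] by (elim exE conjE) (rule that)
    have "p n \<le> real (t n)" unfolding t_def by linarith
    then have "real (s n) \<le> 2 powr real (t n)"
      using s[rule_format, of n] powr_mono[of "p n" "real (t n)" 2] by linarith
    then have "s n \<le> 2 ^ t n" by (simp add: powr_realpow)
    then have U: "\<forall>U\<in>set Us. finite U \<and> card U \<le> 2 ^ t n" using Us(2) by fastforce
    have "(1 - 1 / real (8 * Suc (t n))) ^ q n \<le> (1 / 2) ^ j n"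
      unfolding q_def by (rule one_minus_inverse_power_le) simp
    then have q: "(1 - 1 / (8 * (real (t n) + 1))) ^ q n \<le> (1 / 2) ^ j n"
      by (simp add: algebra_simps)
    have "approximable (bits n \<times> bits n) (2 ^ alternation_exponent (t n) (q n) (length Us))
        ((1 / 2) ^ j n * 2 ^ (Suc (t n) * length Us)) (alternation True (\<lambda>us. A us \<times> B us) Us [])"
      by (rule approximable_alternation[OF _ _ q U]) (auto simp: finite_bits)
    moreover have "(1 / 2 :: real) ^ j n * 2 ^ (Suc (t n) * k) = 1 / 64"
      unfolding j_def power_add by (simp add: power_one_over)
    ultimately show ?thesis using Us(1,3) by (simp only: e_def)
  qed
  ultimately show ?thesis by blast
qed

theorem theorem15: "PHcc \<subseteq> BP PPcc"
proof
  fix L assume L: "L \<in> PHcc"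
  from PHcc_approximable[OF this] obtain e where e: "polylog (\<lambda>n. real (e n))"
    "\<forall>n. approximable (bits n \<times> bits n) (2 ^ e n) (1 / 64) (slice L n)"
    by (elim exE conjE) (rule that)
  let ?R = "\<lambda>n. bits (seed_length n)"
  have "\<forall>n. \<exists>f. (\<forall>r\<in>?R n. rect_sum (2 ^ e n) (f r)) \<and>
    (\<forall>z\<in>bits n \<times> bits n. 3 * card {r\<in>?R n. f r z \<noteq> of_bool (z \<in> slice L n)} \<le> card (?R n))"
  proof (rule allI, rule exists_low_error_seeds[OF _ _ _ e(2)[rule_format]])
    fix n
    have "2 * n \<le> 2 ^ seed_length n" using four_times_le_power_seed_length[of n] by simp
    then show "card (bits n \<times> bits n) \<le> 2 ^ card (?R n)"
      by (simp add: card_bits card_cartesian_product flip: power_add)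
  qed (simp_all add: finite_bits)
  then obtain f where "\<forall>n. (\<forall>r\<in>?R n. rect_sum (2 ^ e n) (f n r)) \<and>
    (\<forall>z\<in>bits n \<times> bits n. 3 * card {r\<in>?R n. f n r z \<noteq> of_bool (z \<in> slice L n)} \<le> card (?R n))"
    by (rule choice[THEN exE])
  then have f: "\<And>n r. r \<in> ?R n \<Longrightarrow> rect_sum (2 ^ e n) (f n r)"
    and err: "\<And>n z. z \<in> bits n \<times> bits n \<Longrightarrow>
      3 * card {r\<in>?R n. f n r z \<noteq> of_bool (z \<in> slice L n)} \<le> card (?R n)"
    by blast+
  let ?L' = "seeded_language seed_length f"
  have L': "?L' \<in> PPcc" using f e(1) by (rule seeded_language_in_PPcc)
  have poly: "poly_bounded (\<lambda>t. t + 2)"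
    unfolding poly_bounded_def by (intro exI[of _ 2] exI[of _ 1]) auto
  have frac: "((x, y) \<notin> L \<longrightarrow> a / real (card (?R n)) \<le> 1 / 3) \<and>
      ((x, y) \<in> L \<longrightarrow> a / real (card (?R n)) \<ge> 2 / 3)"
    if xy: "x \<in> bits n" "y \<in> bits n"
      and a: "a = real (card {r\<in>?R n. (pair_str x r, pair_str y r) \<in> ?L'})" for n x y a
  proof -
    \<comment> \<open>A seed with the exact value 0 or 1 has the correct sign, so acceptance differs
      from membership only on \<open>?bad\<close>, at most a third of the seeds.\<close>
    let ?acc = "{r\<in>?R n. f n r (x, y) > 0}"
    let ?bad = "{r\<in>?R n. f n r (x, y) \<noteq> of_bool ((x, y) \<in> slice L n)}"
    have "{r\<in>?R n. (pair_str x r, pair_str y r) \<in> ?L'} = ?acc"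
      using xy pair_str_in_seeded_language[of x n _ seed_length y f] by blast
    then have acc: "a = real (card ?acc)" using a by simp
    have R: "finite (?R n)" "0 < card (?R n)" by (auto simp: finite_bits card_bits)
    have bad: "3 * card ?bad \<le> card (?R n)" using xy by (intro err) simp
    have slice: "(x, y) \<in> slice L n \<longleftrightarrow> (x, y) \<in> L" using xy by (simp add: slice_def)
    show ?thesis
    proof (cases "(x, y) \<in> L")
      case True
      then have "?R n \<subseteq> ?acc \<union> ?bad" using slice by auto
      then have "card (?R n) \<le> card (?acc \<union> ?bad)" using R by (intro card_mono) auto
      also have "\<dots> \<le> card ?acc + card ?bad" by (rule card_Un_le)
      finally have "2 * card (?R n) \<le> 3 * card ?acc" using bad by linarith
      then show ?thesis using True R acc by (simp add: field_simps)
    next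
      case False
      then have "?acc \<subseteq> ?bad" using slice by auto
      then have "card ?acc \<le> card ?bad" using R by (intro card_mono) auto
      then have "3 * card ?acc \<le> card (?R n)" using bad by linarith
      then show ?thesis using False R acc by (simp add: field_simps)
    qed
  qed
  have "is_language L" using L by (simp add: PHcc_def)
  then show "L \<in> BP PPcc"
    unfolding BP_def Let_def mem_Collect_eq
    by (intro conjI bexI[OF _ L'] exI[of _ "\<lambda>t. t + 2"] poly allI ballI; (fold seed_length_def)?)
      (assumption | rule frac[OF _ _ refl, THEN conjunct1] frac[OF _ _ refl, THEN conjunct2])+
qed

end
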